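(* Let $n\ge1$ and let $f(q)=\sum_{m=0}^n q^m a_m$ and $h(q)=\sum_{m=0}^n q^m b_m$ be elements of $\mathcal P_n$. Then $f$ and $h$ are $\Gamma_{\mathrm{univ}}$-equivalent if and only if there exists $\eta\in\mathbb H^\times$ such that $$b_mb_n^{-1}=\eta\,(a_ma_n^{-1})\,\eta^{-1}\qquad\text{for all }m=1,\dots,n-1.$$ Equivalently, the map $$\mathcal P_n/\Gamma_{\mathrm{univ}}\longrightarrow\mathcal N_n/\!\sim,\qquad[f]\longmapsto[\mathcal N(f)]$$ is a bijection.
   Context: $\mathbb H$ denotes the quaternions, $\mathbb H^\times=\mathbb H\smallsetminus\{0\}$, $\mathbb S=\{q\in\mathbb H: q^2=-1\}$. Fix $i,j\in\mathbb S$ with $ij=-ji$, and put $\mathbb C:=\mathbb R+\mathbb R i\subset\mathbb H$. Let $\Omega\subset\mathbb H$ be a symmetric slice domain: a domain with $\Omega\cap\mathbb R\ne\emptyset$, with $\Omega_I:=\Omega\cap(\mathbb R+\mathbb R I)$ a domain for all $I\in\mathbb S$, and such that $x+yI\in\Omega$ implies $x+yI'\in\Omega$ for all $I,I'\in\mathbb S$. $f:\Omega\to\mathbb H$ is slice regular if for every $I\in\mathbb S$ one has $\frac12(\partial_x+I\partial_y)f(x+yI)=0$ on $\Omega_I$; $\mathrm{SR}(\Omega,\mathbb H)$ is the set of such functions. Polynomials $\sum_m q^ma_m$ with right coefficients are slice regular. For $f\in\mathrm{SR}(\Omega,\mathbb H)$ write $f(z)=g(z)+h(z)j$ on $\Omega_i$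 with $g,h:\Omega_i\to\mathbb C$ holomorphic, put $\hat g(z)=\overline{g(\overline z)}$, $\hat h(z)=\overline{h(\overline z)}$, and $\Phi_f(z)=\begin{pmatrix} g(z) & -\hat h(z) \\ h(z) & \hat g(z) \end{pmatrix}$. Let $\mathcal B_{\mathbb H}$ be the group of matrices $T=\begin{pmatrix} A & 0 \\ C & D \end{pmatrix}\in\mathrm{GL}(4,\mathbb C)$ whose $2\times2$ blocks $A,C,D$ have the form $\begin{pmatrix} z & -\overline w \\ w & \overline z \end{pmatrix}$, and $\Gamma_{\mathrm{univ}}:=\mathcal B_{\mathbb H}/\mathbb R^\times$. It acts on $\mathrm{SR}(\Omega,\mathbb H)$ by letting $[T]^*f$ be the unique slice-regular function with $\Phi_{[T]^*f}=(C+D\Phi_f)A^{-1}$. Two functions $f_1,f_2$ are $\Gamma_{\mathrm{univ}}$-equivalent if $f_2=[T]^*f_1$ for some $[T]\in\Gamma_{\mathrm{univ}}$. $\mathcal P_n:=\{\sum_{m=0}^n q^ma_m: a_m\in\mathbb H,\ a_n\ne0\}$ (which is preserved by the action); $\mathcal N_n:=\{q^n+\sum_{m=1}^{n-1}q^mb_m: b_m\in\mathbb H\}$; $\mathcal N:\mathcal P_n\to\mathcal N_n$, $\mathcal N(\sum_{m=0}^n q^ma_m)=q^n+\sum_{m=1}^{n-1}q^ma_ma_n^{-1}$. Two elements $q^n+\sum_{m=1}^{n-1}q^mb_m$ and $q^n+\sum_{m=1}^{n-1}q^mc_m$ of $\mathcal N_n$ are simultaneously conjugate (written $\sim$) if there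 is $\eta\in\mathbb H^\times$ with $c_m=\eta b_m\eta^{-1}$ for all $m=1,\dots,n-1$. *)

theory Defs
  imports "HOL-Analysis.Analysis" "HOL-Algebra.Coset"
begin

section \<open>Quaternions\<close>

datatype quat = Quat (qre: real) (qim1: real) (qim2: real) (qim3: real)

lemma quat_eq_iff:
  "p = q \<longleftrightarrow> qre p = qre q \<and> qim1 p = qim1 q \<and> qim2 p = qim2 q \<and> qim3 p = qim3 q"
  by (cases p; cases q) simp

instantiation quat :: ring_1
begin
definition "0 = Quat 0 0 0 0"
definition "1 = Quat 1 0 0 0"
definition "p + q = Quat (qre p + qre q) (qim1 p + qim1 q) (qim2 p + qim2 q) (qim3 p + qim3 q)"
definition "- p = Quat (- qre p) (- qim1 p) (- qim2 p) (- qim3 p)"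
definition "p - q = Quat (qre p - qre q) (qim1 p - qim1 q) (qim2 p - qim2 q) (qim3 p - qim3 q)"
definition "p * q = Quat
  (qre p * qre q - qim1 p * qim1 q - qim2 p * qim2 q - qim3 p * qim3 q)
  (qre p * qim1 q + qim1 p * qre q + qim2 p * qim3 q - qim3 p * qim2 q)
  (qre p * qim2 q - qim1 p * qim3 q + qim2 p * qre q + qim3 p * qim1 q)
  (qre p * qim3 q + qim1 p * qim2 q - qim2 p * qim1 q + qim3 p * qre q)"
instance
  by standard
    (simp_all add: quat_eq_iff zero_quat_def one_quat_def plus_quat_def uminus_quat_def
      minus_quat_def times_quat_def algebra_simps)
end

lemma quat_sel [simp]:
  "qre 0 = 0" "qim1 0 = 0" "qim2 0 = 0" "qim3 0 = 0"
  "qre 1 = 1" "qim1 1 = 0" "qim2 1 = 0" "qim3 1 = 0"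
  "qre (p + q) = qre p + qre q" "qim1 (p + q) = qim1 p + qim1 q"
  "qim2 (p + q) = qim2 p + qim2 q" "qim3 (p + q) = qim3 p + qim3 q"
  "qre (- p) = - qre p" "qim1 (- p) = - qim1 p"
  "qim2 (- p) = - qim2 p" "qim3 (- p) = - qim3 p"
  "qre (p - q) = qre p - qre q" "qim1 (p - q) = qim1 p - qim1 q"
  "qim2 (p - q) = qim2 p - qim2 q" "qim3 (p - q) = qim3 p - qim3 q"
  by (simp_all add: zero_quat_def one_quat_def plus_quat_def uminus_quat_def minus_quat_def)

instantiation quat :: real_vector
begin
definition "r *\<^sub>R q = Quat (r * qre q) (r * qim1 q) (r * qim2 q) (r * qim3 q)" for q :: quat
instance
  by standard (simp_all add: scaleR_quat_def quat_eq_iff algebra_simps)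
end

instantiation quat :: real_inner
begin
definition "p \<bullet> q = qre p * qre q + qim1 p * qim1 q + qim2 p * qim2 q + qim3 p * qim3 q"
definition norm_quat :: "quat \<Rightarrow> real" where "norm_quat q = sqrt (q \<bullet> q)"
definition sgn_quat :: "quat \<Rightarrow> quat" where "sgn_quat q = q /\<^sub>R norm q"
definition dist_quat :: "quat \<Rightarrow> quat \<Rightarrow> real" where "dist_quat p q = norm (p - q)"
definition uniformity_quat :: "(quat \<times> quat) filter"
  where "uniformity_quat = (INF e\<in>{0<..}. principal {(p, q). dist p q < e})"
definition open_quat :: "quat set \<Rightarrow> bool"
  where "open_quat U = (\<forall>p\<in>U. eventually (\<lambda>(p', q). p' = p \<longrightarrow> q \<in> U) uniformity)"
instance
proof
  fix p q r :: quat and s t :: real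
  show "0 \<le> p \<bullet> p" by (simp add: inner_quat_def)
  show "p \<bullet> p = 0 \<longleftrightarrow> p = 0"
    by (simp add: inner_quat_def quat_eq_iff)
      (smt (verit) mult_eq_0_iff zero_le_square)
qed (simp_all add: scaleR_quat_def inner_quat_def norm_quat_def sgn_quat_def dist_quat_def
      uniformity_quat_def open_quat_def quat_eq_iff algebra_simps)
end

instantiation quat :: division_ring
begin
definition "inverse q = Quat (qre q / (q \<bullet> q)) (- qim1 q / (q \<bullet> q))
  (- qim2 q / (q \<bullet> q)) (- qim3 q / (q \<bullet> q))"
definition "p div q = p * inverse q" for p q :: quat
instance
proof
  fix p q :: quat
  show "inverse (0 :: quat) = 0" by (simp add: inverse_quat_def zero_quat_def)
  show "p div q = p * inverse q" by (simp add: divide_quat_def)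
  assume "p \<noteq> 0"
  then have nz: "p \<bullet> p \<noteq> 0" by simp
  have sq: "qre p * qre p + qim1 p * qim1 p + qim2 p * qim2 p + qim3 p * qim3 p = p \<bullet> p"
    by (simp add: inner_quat_def)
  have "(qre p * qre p + qim1 p * qim1 p + qim2 p * qim2 p + qim3 p * qim3 p) / (p \<bullet> p) = 1"
    unfolding sq using nz by simp
  then show "inverse p * p = 1" "p * inverse p = 1"
    by (simp_all add: quat_eq_iff inverse_quat_def times_quat_def add_divide_distrib)
qed
end

instance quat :: real_normed_div_algebra
proof
  fix p q :: quat and s :: real
  show "s *\<^sub>R p * q = s *\<^sub>R (p * q)" "p * s *\<^sub>R q = s *\<^sub>R (p * q)"
    by (simp_all add: scaleR_quat_def times_quat_def algebra_simps)
  show "norm (p * q) = norm p * norm q"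
    unfolding norm_quat_def real_sqrt_mult[symmetric]
    by (rule arg_cong[where f = sqrt]) (simp add: inner_quat_def times_quat_def algebra_simps)
qed

section \<open>Slice regular functions\<close>

definition imaginary_units :: "quat set" where
  "imaginary_units = {q. q\<^sup>2 = - 1}"

text \<open>The map \<open>x + y\<i> \<mapsto> x + y I\<close> identifies the type \<open>complex\<close> with the plane
  \<open>\<real> + \<real> I\<close>; \<open>slice I \<Omega>\<close> is \<open>\<Omega> \<inter> (\<real> + \<real> I)\<close> under this identification.\<close>

definition slice_point :: "quat \<Rightarrow> complex \<Rightarrow> quat" where
  "slice_point I z = of_real (Re z) + of_real (Im z) * I"

definition slice :: "quat \<Rightarrow> quat set \<Rightarrow> complex set" where
  "slice I \<Omega> = {z. slice_point I z \<in> \<Omega>}"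

definition symmetric_slice_domain :: "quat set \<Rightarrow> bool" where
  "symmetric_slice_domain \<Omega> \<longleftrightarrow>
     open \<Omega> \<and> connected \<Omega> \<and> \<Omega> \<inter> range of_real \<noteq> {} \<and>
     (\<forall>I\<in>imaginary_units. open (slice I \<Omega>) \<and> connected (slice I \<Omega>)) \<and>
     (\<forall>I\<in>imaginary_units. \<forall>I'\<in>imaginary_units. \<forall>x y :: real.
        of_real x + of_real y * I \<in> \<Omega> \<longrightarrow> of_real x + of_real y * I' \<in> \<Omega>)"

text \<open>Functions on \<open>\<Omega>\<close> are represented extensionally, so that equality of functions means equality
  on \<open>\<Omega>\<close>. For the derivative \<open>D\<close> of \<open>x + y\<i> \<mapsto> f (x + y I)\<close>, the values \<open>D 1\<close> and \<open>D \<i>\<close> are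
  the partial derivatives in \<open>x\<close> and \<open>y\<close>; existence of partial derivatives alone would
  not imply that \<open>f\<close> is holomorphic on slices.\<close>

definition slice_regular_on :: "quat set \<Rightarrow> (quat \<Rightarrow> quat) set" where
  "slice_regular_on \<Omega> = {f \<in> extensional \<Omega>.
     \<forall>I\<in>imaginary_units. \<forall>z\<in>slice I \<Omega>.
       \<exists>D. ((\<lambda>w. f (slice_point I w)) has_derivative D) (at z) \<and>
           (1 / 2) *\<^sub>R (D 1 + I * D \<i>) = 0}"

section \<open>The matrix of a slice regular function\<close>

definition splitting :: "quat \<Rightarrow> quat \<Rightarrow> quat \<Rightarrow> complex \<times> complex" where
  "splitting i j q = (THE p. q = slice_point i (fst p) + slice_point i (snd p) * j)"

definition split_fst :: "quat \<Rightarrow> quat \<Rightarrow> (quat \<Rightarrow> quat) \<Rightarrow> complex \<Rightarrow> complex" where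
  "split_fst i j f z = fst (splitting i j (f (slice_point i z)))"

definition split_snd :: "quat \<Rightarrow> quat \<Rightarrow> (quat \<Rightarrow> quat) \<Rightarrow> complex \<Rightarrow> complex" where
  "split_snd i j f z = snd (splitting i j (f (slice_point i z)))"

definition hat :: "(complex \<Rightarrow> complex) \<Rightarrow> complex \<Rightarrow> complex" where
  "hat g z = cnj (g (cnj z))"

definition \<Phi> :: "quat \<Rightarrow> quat \<Rightarrow> (quat \<Rightarrow> quat) \<Rightarrow> complex \<Rightarrow> complex^2^2" where
  "\<Phi> i j f z = vector
     [vector [split_fst i j f z, - hat (split_snd i j f) z],
      vector [split_snd i j f z, hat (split_fst i j f) z]]"

section \<open>The group and its action\<close>

definition quat_matrices :: "(complex^2^2) set" where
  "quat_matrices = {vector [vector [z, - cnj w], vector [w, cnj z]] | z w. True}"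

definition upper :: "2 \<Rightarrow> 4" where
  "upper a = (if a = 1 then 1 else 2)"

definition lower :: "2 \<Rightarrow> 4" where
  "lower a = (if a = 1 then 3 else 4)"

definition block :: "(2 \<Rightarrow> 4) \<Rightarrow> (2 \<Rightarrow> 4) \<Rightarrow> complex^4^4 \<Rightarrow> complex^2^2" where
  "block r s T = (\<chi> a b. T $ r a $ s b)"

definition B_H :: "(complex^4^4) monoid" where
  "B_H = \<lparr>carrier = {T. invertible T \<and> block upper lower T = 0 \<and>
            block upper upper T \<in> quat_matrices \<and>
            block lower upper T \<in> quat_matrices \<and>
            block lower lower T \<in> quat_matrices},
          mult = (**), one = mat 1\<rparr>"

definition real_scalars :: "(complex^4^4) set" where
  "real_scalars = {mat (of_real r) | r :: real. r \<noteq> 0}"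

definition \<Gamma>_univ :: "(complex^4^4) set monoid" where
  "\<Gamma>_univ = B_H Mod real_scalars"

text \<open>An element \<open>X\<close> of \<open>\<Gamma>_univ\<close> is a coset; the defining equation does not depend on the
  representative \<open>T \<in> X\<close>.\<close>

definition pullback ::
    "quat \<Rightarrow> quat \<Rightarrow> quat set \<Rightarrow> (complex^4^4) set \<Rightarrow> (quat \<Rightarrow> quat) \<Rightarrow> quat \<Rightarrow> quat" where
  "pullback i j \<Omega> X f = (THE F. F \<in> slice_regular_on \<Omega> \<and>
     (\<forall>T\<in>X. \<forall>z\<in>slice i \<Omega>.
        \<Phi> i j F z = (block lower upper T + block lower lower T ** \<Phi> i j f z)
                     ** matrix_inv (block upper upper T)))"

definition \<Gamma>_equivalent ::
    "quat \<Rightarrow> quat \<Rightarrow> quat set \<Rightarrow> (quat \<Rightarrow> quat) \<Rightarrow> (quat \<Rightarrow> quat) \<Rightarrow> bool" where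
  "\<Gamma>_equivalent i j \<Omega> f1 f2 \<longleftrightarrow> (\<exists>X\<in>carrier \<Gamma>_univ. f2 = pullback i j \<Omega> X f1)"

section \<open>Polynomials and their normalisation\<close>

definition poly_fun :: "quat set \<Rightarrow> nat \<Rightarrow> (nat \<Rightarrow> quat) \<Rightarrow> quat \<Rightarrow> quat" where
  "poly_fun \<Omega> n a = (\<lambda>q\<in>\<Omega>. \<Sum>m = 0..n. q ^ m * a m)"

definition normal_fun :: "quat set \<Rightarrow> nat \<Rightarrow> (nat \<Rightarrow> quat) \<Rightarrow> quat \<Rightarrow> quat" where
  "normal_fun \<Omega> n b = (\<lambda>q\<in>\<Omega>. q ^ n + (\<Sum>m = 1..n - 1. q ^ m * b m))"

definition polys :: "quat set \<Rightarrow> nat \<Rightarrow> (quat \<Rightarrow> quat) set" where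
  "polys \<Omega> n = {poly_fun \<Omega> n a | a. a n \<noteq> 0}"

definition normal_polys :: "quat set \<Rightarrow> nat \<Rightarrow> (quat \<Rightarrow> quat) set" where
  "normal_polys \<Omega> n = range (normal_fun \<Omega> n)"

text \<open>On a symmetric slice domain the coefficients are determined by the function.\<close>

definition normalise :: "quat set \<Rightarrow> nat \<Rightarrow> (quat \<Rightarrow> quat) \<Rightarrow> quat \<Rightarrow> quat" where
  "normalise \<Omega> n f = (THE F. \<exists>a. a n \<noteq> 0 \<and> f = poly_fun \<Omega> n a \<and>
     F = normal_fun \<Omega> n (\<lambda>m. a m * inverse (a n)))"

definition \<Gamma>_rel :: "quat \<Rightarrow> quat \<Rightarrow> quat set \<Rightarrow> nat \<Rightarrow> ((quat \<Rightarrow> quat) \<times> (quat \<Rightarrow> quat)) set" where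
  "\<Gamma>_rel i j \<Omega> n = {(f, h) \<in> polys \<Omega> n \<times> polys \<Omega> n. \<Gamma>_equivalent i j \<Omega> f h}"

definition conj_rel :: "quat set \<Rightarrow> nat \<Rightarrow> ((quat \<Rightarrow> quat) \<times> (quat \<Rightarrow> quat)) set" where
  "conj_rel \<Omega> n = {(normal_fun \<Omega> n b, normal_fun \<Omega> n c) | b c.
     \<exists>\<eta>. \<eta> \<noteq> 0 \<and> (\<forall>m\<in>{1..n - 1}. c m = \<eta> * b m * inverse \<eta>)}"

end

theory Submission
  imports Defs "HOL-Complex_Analysis.Conformal_Mappings"
begin

text \<open>Sending a quaternion \<open>q = \<alpha> + \<beta> j\<close> to the matrix \<open>qmat q\<close> with first column \<open>(\<alpha>, \<beta>)\<close> embeds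
  \<open>\<H>\<close> into the complex \<open>2 \<times> 2\<close> matrices, with image \<open>quat_matrices\<close>, and reverses products. For a
  polynomial \<open>f = \<Sum> q\<^sup>m a\<^sub>m\<close> one has \<open>\<Phi>\<^sub>f(z) = \<Sum> z\<^sup>m qmat a\<^sub>m\<close>. Hence, when \<open>A\<close>, \<open>C\<close>, \<open>D\<close> are the matrices
  of \<open>p\<close>, \<open>c\<close>, \<open>d\<close>, the function \<open>(C + D \<Phi>\<^sub>f) A\<^sup>-\<^sup>1\<close> is \<open>\<Phi>\<close> of the polynomial with coefficients
  \<open>p\<^sup>-\<^sup>1 a\<^sub>m d\<close> for \<open>m \<ge> 1\<close> and \<open>p\<^sup>-\<^sup>1 (a\<^sub>0 d + c)\<close> for \<open>m = 0\<close>
  (lemma \<open>\<Phi>_affine\<close>). The action therefore multiplies the coefficients by independent nonzero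
  constants on the two sides and moves the constant term freely. Dividing by the leading
  coefficient removes \<open>d\<close>, and what remains is conjugation by \<open>\<eta> = p\<^sup>-\<^sup>1\<close>. Conversely, \<open>\<eta>\<close>
  determines \<open>p\<close>; the leading coefficients then determine \<open>d\<close>, and the constant terms \<open>c\<close>
  (lemma \<open>\<Gamma>_equivalent_iff_conjugate\<close>).

  The pullback is a definite description, so this computation identifies it only together with a
  uniqueness statement: a slice regular function is determined by its values on the real points of
  \<open>\<Omega>\<close>, hence by \<open>\<Phi>\<close> (lemmas \<open>slice_regular_eqI\<close> and \<open>slice_regular_eq_if_\<Phi>_eq\<close>). On each slice
  this is the identity theorem for holomorphic functions, applied to the complex-linear
  coordinates of the function. The same real points show that the coefficients of a polynomial are
  determined by the function (lemma \<open>poly_fun_eq_iff\<close>), so that the normalisation is well defined.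

  Finally, \<open>\<Gamma>\<close>-equivalence of polynomials turns out to be the preimage of simultaneous conjugacy
  under normalisation, which maps onto the normal polynomials. A surjection always induces a
  bijection between the quotients by an equivalence relation and by its preimage
  (lemma \<open>quotient_bijection\<close>).\<close>

section \<open>Complex coordinates on quaternions\<close>

text \<open>For \<open>I\<^sup>2 = - 1\<close> left multiplication by \<open>\<real> + \<real> I\<close> makes the quaternions a complex vector space. This is
  a complex linear functional on it, the orthogonal projection onto \<open>\<real> + \<real> I\<close> followed by the
  identification of that plane with \<open>\<complex>\<close>.\<close>
definition slice_coord :: "quat \<Rightarrow> quat \<Rightarrow> complex" where
  "slice_coord I q = Complex (qre q) (q \<bullet> I)"

lemma qre_of_real [simp]:
  "qre (of_real x) = x" "qim1 (of_real x) = 0" "qim2 (of_real x) = 0" "qim3 (of_real x) = 0"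
  by (simp_all add: of_real_def scaleR_quat_def one_quat_def)

lemma imaginary_unitsD:
  assumes "I \<in> imaginary_units"
  shows "qre I = 0" and "(qim1 I)\<^sup>2 + (qim2 I)\<^sup>2 + (qim3 I)\<^sup>2 = 1"
proof -
  have sq: "I * I = - 1"
    using assms by (simp add: imaginary_units_def power2_eq_square)
  have re: "qre I * qre I - qim1 I * qim1 I - qim2 I * qim2 I - qim3 I * qim3 I = - 1"
    and im: "qre I * qim1 I = 0" "qre I * qim2 I = 0" "qre I * qim3 I = 0"
    using arg_cong[OF sq, of qre] arg_cong[OF sq, of qim1] arg_cong[OF sq, of qim2]
      arg_cong[OF sq, of qim3] by (auto simp: times_quat_def)
  show r: "qre I = 0"
  proof (rule ccontr)
    assume "qre I \<noteq> 0"
    with re im have "qre I * qre I = - 1" by auto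
    then show False by (smt (verit) zero_le_square)
  qed
  show "(qim1 I)\<^sup>2 + (qim2 I)\<^sup>2 + (qim3 I)\<^sup>2 = 1"
    using re r by (simp add: power2_eq_square)
qed

lemma imaginary_unit_square: "I \<in> imaginary_units \<Longrightarrow> I * I = - 1"
  by (simp add: imaginary_units_def power2_eq_square)

lemma minus_imaginary_units: "I \<in> imaginary_units \<Longrightarrow> - I \<in> imaginary_units"
  by (simp add: imaginary_units_def)

lemma slice_point_coords:
  "qre (slice_point I z) = Re z + Im z * qre I" "qim1 (slice_point I z) = Im z * qim1 I"
  "qim2 (slice_point I z) = Im z * qim2 I" "qim3 (slice_point I z) = Im z * qim3 I"
  by (simp_all add: slice_point_def times_quat_def)

lemma slice_point_simps [simp]:
  "slice_point I 0 = 0" "slice_point I 1 = 1" "slice_point I (of_real x) = of_real x"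
  "slice_point I \<i> = I"
  by (simp_all add: slice_point_def)

lemma slice_point_mult:
  assumes "I \<in> imaginary_units"
  shows "slice_point I (z * w) = slice_point I z * slice_point I w"
proof -
  have "of_real y * I * (of_real v * I) = - of_real (y * v)" for y v :: real
  proof -
    have "of_real y * I * (of_real v * I) = of_real y * (I * of_real v) * I"
      by (simp only: mult.assoc)
    also have "I * of_real v = of_real v * I"
      by (simp add: of_real_def)
    also have "of_real y * (of_real v * I) * I = of_real y * of_real v * (I * I)"
      by (simp only: mult.assoc)
    finally show ?thesis
      by (simp add: imaginary_unit_square[OF assms])
  qed
  then show ?thesis
    by (simp add: slice_point_def algebra_simps) (simp add: of_real_def mult.commute)
qed

lemma slice_point_power:
  "I \<in> imaginary_units \<Longrightarrow> slice_point I (z ^ m) = slice_point I z ^ m"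
  by (induction m) (simp_all add: slice_point_mult)

lemma bounded_linear_slice_point: "bounded_linear (slice_point I)"
proof -
  have "slice_point I = (\<lambda>z. Re z *\<^sub>R 1 + Im z *\<^sub>R I)"
    by (simp add: slice_point_def fun_eq_iff scaleR_conv_of_real)
  then show ?thesis
    by (auto intro!: bounded_linear_intros bounded_linear_Re bounded_linear_Im)
qed

lemma bounded_linear_slice_coord: "bounded_linear (slice_coord I)"
proof -
  have "slice_coord I = (\<lambda>q. (q \<bullet> 1) *\<^sub>R 1 + (q \<bullet> I) *\<^sub>R \<i>)"
    by (auto simp: slice_coord_def fun_eq_iff complex_eq_iff inner_quat_def)
  then show ?thesis
    by (auto intro!: bounded_linear_intros)
qed

lemma slice_coord_add: "slice_coord I (p + q) = slice_coord I p + slice_coord I q"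
  by (intro linear_add bounded_linear.linear bounded_linear_slice_coord)

lemma slice_coord_diff: "slice_coord I (p - q) = slice_coord I p - slice_coord I q"
  by (intro linear_diff bounded_linear.linear bounded_linear_slice_coord)

lemma slice_coord_scaleR: "slice_coord I (r *\<^sub>R q) = r *\<^sub>R slice_coord I q"
  by (intro linear_scale bounded_linear.linear bounded_linear_slice_coord)

lemma slice_coord_minus: "slice_coord I (- q) = - slice_coord I q"
  by (intro linear_neg bounded_linear.linear bounded_linear_slice_coord)

lemma slice_coord_zero [simp]: "slice_coord I 0 = 0"
  by (intro linear_0 bounded_linear.linear bounded_linear_slice_coord)

lemma slice_coord_sum: "slice_coord I (\<Sum>x\<in>A. f x) = (\<Sum>x\<in>A. slice_coord I (f x))"
  by (intro linear_sum bounded_linear.linear bounded_linear_slice_coord)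

text \<open>Both components of the complex linearity come from \<open>I \<bullet> 1 = 0\<close> and \<open>I \<bullet> I = 1\<close>.\<close>
lemma slice_coord_mult_left:
  assumes "I \<in> imaginary_units"
  shows "slice_coord I (slice_point I z * q) = z * slice_coord I q"
proof (rule complex_eqI)
  note I = imaginary_unitsD[OF assms]
  show "Re (slice_coord I (slice_point I z * q)) = Re (z * slice_coord I q)"
    by (simp add: slice_coord_def slice_point_coords I times_quat_def inner_quat_def algebra_simps)
  have "Im (slice_coord I (slice_point I z * q)) =
    Re z * (q \<bullet> I) + Im z * qre q * ((qim1 I)\<^sup>2 + (qim2 I)\<^sup>2 + (qim3 I)\<^sup>2)"
    by (simp add: slice_coord_def slice_point_coords I times_quat_def inner_quat_def
        power2_eq_square algebra_simps)
  then show "Im (slice_coord I (slice_point I z * q)) = Im (z * slice_coord I q)"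
    by (simp add: slice_coord_def I)
qed

text \<open>Right multiplications commute with the complex structure given by \<open>I\<close>, so \<open>slice_coord I (q * p)\<close> is
  complex linear in \<open>q\<close> for every \<open>p\<close>. Separation of points by these functionals allows results on
  holomorphic functions to be applied to quaternion-valued functions without choosing a unit
  orthogonal to \<open>I\<close>.\<close>
lemma eq_0_if_slice_coords_0:
  assumes "\<And>p. slice_coord I (q * p) = 0"
  shows "q = 0"
  using assms[of "inverse q"] by (cases "q = 0") (auto simp: slice_coord_def complex_eq_iff)

section \<open>Slice regularity in coordinates\<close>

text \<open>The equation \<open>D 1 + I D \<i> = 0\<close> says that the real derivative \<open>D\<close> is complex linear for left
  multiplication by \<open>I\<close>, and it is composed with a complex linear functional.\<close>
lemma slice_regular_coord_holomorphic:
  assumes f: "f \<in> slice_regular_on \<Omega>" and I: "I \<in> imaginary_units" and op: "open (slice I \<Omega>)"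
  shows "(\<lambda>w. slice_coord I (f (slice_point I w) * p)) holomorphic_on slice I \<Omega>"
  unfolding holomorphic_on_open[OF op]
proof
  fix z assume "z \<in> slice I \<Omega>"
  then obtain D where D: "((\<lambda>w. f (slice_point I w)) has_derivative D) (at z)"
    and eq: "(1 / 2) *\<^sub>R (D 1 + I * D \<i>) = 0"
    using f I by (auto simp: slice_regular_on_def)
  let ?G = "\<lambda>q. slice_coord I (q * p)"
  have G: "bounded_linear ?G"
    using bounded_linear_compose[OF bounded_linear_slice_coord bounded_linear_mult_left] .
  have D\<i>: "D \<i> = I * D 1"
  proof -
    have "D 1 = - (I * D \<i>)" using eq by (simp add: eq_neg_iff_add_eq_0)
    then have "I * D 1 = - (I * I * D \<i>)" by (simp add: mult.assoc)
    then show ?thesis by (simp add: imaginary_unit_square[OF I])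
  qed
  have "?G (D h) = ?G (D 1) * h" for h
  proof -
    interpret D: bounded_linear D using D by (rule has_derivative_bounded_linear)
    have "h = Re h *\<^sub>R 1 + Im h *\<^sub>R \<i>" by (simp add: complex_eq_iff)
    then have "D h = Re h *\<^sub>R D 1 + Im h *\<^sub>R D \<i>"
      by (metis D.add D.scaleR)
    also have "\<dots> = slice_point I h * D 1"
      by (simp add: D\<i> slice_point_def scaleR_conv_of_real algebra_simps)
    finally show ?thesis
      by (simp add: slice_coord_mult_left[OF I] mult.assoc)
  qed
  then have linear: "(*) (?G (D 1)) = (\<lambda>h. ?G (D h))" by (intro ext) (rule sym)
  have "((\<lambda>w. ?G (f (slice_point I w))) has_field_derivative ?G (D 1)) (at z)"
    unfolding has_field_derivative_def linear by (rule bounded_linear.has_derivative[OF G D])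
  then show "\<exists>f'. ((\<lambda>w. ?G (f (slice_point I w))) has_field_derivative f') (at z)" ..
qed

text \<open>On the slice of \<open>I\<close> the polynomial is a sum of complex monomials multiplied on the right
  by constants, so the complex linearity of the derivative is inherited from the monomials.\<close>
lemma poly_fun_slice_regular:
  assumes op: "\<And>I. I \<in> imaginary_units \<Longrightarrow> open (slice I \<Omega>)"
  shows "poly_fun \<Omega> n a \<in> slice_regular_on \<Omega>"
proof -
  have "\<exists>D. ((\<lambda>w. poly_fun \<Omega> n a (slice_point I w)) has_derivative D) (at z) \<and>
            (1 / 2) *\<^sub>R (D 1 + I * D \<i>) = 0"
    if I: "I \<in> imaginary_units" and z: "z \<in> slice I \<Omega>" for I z
  proof -
    define D where "D h = (\<Sum>m = 0..n. slice_point I (h * (of_nat m * z ^ (m - 1))) * a m)" for h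
    have "((\<lambda>w. slice_point I (w ^ m) * a m) has_derivative
        (\<lambda>h. slice_point I (h * (of_nat m * z ^ (m - 1))) * a m)) (at z)" for m
      by (rule bounded_linear.has_derivative[OF bounded_linear_compose[OF
            bounded_linear_mult_left bounded_linear_slice_point]])
        (auto intro!: derivative_eq_intros simp: mult_ac)
    then have "((\<lambda>w. \<Sum>m = 0..n. slice_point I (w ^ m) * a m) has_derivative D) (at z)"
      unfolding D_def by (intro has_derivative_sum)
    then have "((\<lambda>w. poly_fun \<Omega> n a (slice_point I w)) has_derivative D) (at z)"
      using op[OF I] z
      by (elim has_derivative_transform_within_open)
        (auto simp: poly_fun_def slice_def slice_point_power[OF I])
    moreover have "D 1 + I * D \<i> = 0"
      by (simp add: D_def sum_distrib_left slice_point_mult[OF I] mult.assoc[symmetric]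
          imaginary_unit_square[OF I] sum.distrib[symmetric])
    ultimately show ?thesis by auto
  qed
  then show ?thesis
    by (auto simp: slice_regular_on_def poly_fun_def)
qed

section \<open>The identity principle\<close>

lemma ex_real_interval_in:
  assumes "symmetric_slice_domain \<Omega>"
  shows "\<exists>x0 e. e > 0 \<and> (\<forall>x :: real. \<bar>x - x0\<bar> < e \<longrightarrow> of_real x \<in> \<Omega>)"
proof -
  obtain x0 :: real where "of_real x0 \<in> \<Omega>" and op: "open \<Omega>"
    using assms by (auto simp: symmetric_slice_domain_def)
  then obtain e where "e > 0" and e: "\<And>q. dist q (of_real x0) < e \<Longrightarrow> q \<in> \<Omega>"
    by (meson open_dist)
  have "of_real x \<in> \<Omega>" if "\<bar>x - x0\<bar> < e" for x
    using that by (intro e) (simp add: dist_norm flip: of_real_diff)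
  with \<open>e > 0\<close> show ?thesis by blast
qed

text \<open>On a real quaternion every unit will do; \<open>Quat 0 1 0 0\<close> is an arbitrary choice.\<close>
lemma obtain_slice:
  obtains I z where "I \<in> imaginary_units" and "q = slice_point I z"
proof -
  define s where "s = sqrt ((qim1 q)\<^sup>2 + (qim2 q)\<^sup>2 + (qim3 q)\<^sup>2)"
  have s2: "s\<^sup>2 = (qim1 q)\<^sup>2 + (qim2 q)\<^sup>2 + (qim3 q)\<^sup>2" by (simp add: s_def)
  show ?thesis
  proof (cases "s = 0")
    case True
    then have "qim1 q = 0" "qim2 q = 0" "qim3 q = 0"
      unfolding s_def by (simp_all add: add_nonneg_eq_0_iff)
    then have "q = slice_point (Quat 0 1 0 0) (of_real (qre q))"
      by (simp add: quat_eq_iff)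
    moreover have "Quat 0 1 0 0 \<in> imaginary_units"
      by (simp add: imaginary_units_def power2_eq_square times_quat_def quat_eq_iff)
    ultimately show ?thesis by (rule that[rotated])
  next
    case False
    define I where "I = Quat 0 (qim1 q / s) (qim2 q / s) (qim3 q / s)"
    have "(qim1 q / s)\<^sup>2 + (qim2 q / s)\<^sup>2 + (qim3 q / s)\<^sup>2 = 1"
      using False by (simp add: power_divide flip: add_divide_distrib s2)
    then have "I \<in> imaginary_units"
      by (simp add: I_def imaginary_units_def power2_eq_square times_quat_def quat_eq_iff)
    moreover have "q = slice_point I (Complex (qre q) s)"
      using False by (simp add: I_def quat_eq_iff slice_point_coords)
    ultimately show ?thesis by (rule that)
  qed
qed

text \<open>The real points of \<open>\<Omega>\<close> contain an interval, which lies in every slice. On the slice through a given point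
  the coordinates of \<open>f - g\<close> are holomorphic and vanish on this interval, hence vanish
  identically because the slice is connected.\<close>
lemma slice_regular_eqI:
  assumes \<Omega>: "symmetric_slice_domain \<Omega>"
    and f: "f \<in> slice_regular_on \<Omega>" and g: "g \<in> slice_regular_on \<Omega>"
    and real: "\<And>x :: real. of_real x \<in> \<Omega> \<Longrightarrow> f (of_real x) = g (of_real x)"
  shows "f = g"
proof -
  obtain x0 e where e: "e > 0" "\<And>x. \<bar>x - x0\<bar> < e \<Longrightarrow> (of_real x :: quat) \<in> \<Omega>"
    using ex_real_interval_in[OF \<Omega>] by blast
  have "f q = g q" if "q \<in> \<Omega>" for q
  proof -
    obtain I z where I: "I \<in> imaginary_units" and q: "q = slice_point I z"
      by (rule obtain_slice)
    have op: "open (slice I \<Omega>)" and conn: "connected (slice I \<Omega>)"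
      using \<Omega> I by (auto simp: symmetric_slice_domain_def)
    have "slice_coord I ((f q - g q) * p) = 0" for p
    proof -
      let ?G = "\<lambda>w. slice_coord I (f (slice_point I w) * p) - slice_coord I (g (slice_point I w) * p)"
      have "?G z = 0"
      proof (rule analytic_continuation[where f = ?G and U = "of_real ` {x0 - e<..<x0 + e}"
            and \<xi> = "of_real x0"])
        show "?G holomorphic_on slice I \<Omega>"
          by (intro holomorphic_intros slice_regular_coord_holomorphic f g I op)
        show "of_real ` {x0 - e<..<x0 + e} \<subseteq> slice I \<Omega>" "of_real x0 \<in> slice I \<Omega>"
          using e by (auto simp: slice_def)
        show "complex_of_real x0 islimpt complex_of_real ` {x0 - e<..<x0 + e}"
          unfolding islimpt_approachable
        proof (intro allI impI)
          fix d :: real assume "d > 0"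
          define x where "x = x0 + min d e / 2"
          have "x \<in> {x0 - e<..<x0 + e}" "x \<noteq> x0" "\<bar>x - x0\<bar> < d"
            using \<open>d > 0\<close> \<open>e > 0\<close> by (auto simp: x_def min_def)
          then show "\<exists>y\<in>complex_of_real ` {x0 - e<..<x0 + e}. y \<noteq> of_real x0 \<and> dist y (of_real x0) < d"
            by (intro bexI[of _ "of_real x"]) (auto simp: dist_real_def)
        qed
        show "?G w = 0" if "w \<in> of_real ` {x0 - e<..<x0 + e}" for w
          using that e(2) real by auto
        show "z \<in> slice I \<Omega>" using \<open>q \<in> \<Omega>\<close> q by (simp add: slice_def)
      qed (fact op conn)+
      then show ?thesis by (simp add: q left_diff_distrib slice_coord_diff)
    qed
    then have "f q - g q = 0" by (rule eq_0_if_slice_coords_0)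
    then show ?thesis by simp
  qed
  moreover have "f \<in> extensional \<Omega>" "g \<in> extensional \<Omega>"
    using f g by (auto simp: slice_regular_on_def)
  ultimately show ?thesis by (intro extensionalityI)
qed

text \<open>At real points the powers of the variable are scalars. The inner product with the difference of
  the \<open>k\<close>-th coefficients thus gives a real polynomial with infinitely many roots whose
  \<open>k\<close>-th coefficient is the squared norm of that difference.\<close>
lemma poly_fun_eq_iff:
  assumes \<Omega>: "symmetric_slice_domain \<Omega>"
  shows "poly_fun \<Omega> n a = poly_fun \<Omega> n b \<longleftrightarrow> (\<forall>m\<le>n. a m = b m)"
proof
  assume eq: "poly_fun \<Omega> n a = poly_fun \<Omega> n b"
  obtain x0 e where e: "e > 0" "\<And>x. \<bar>x - x0\<bar> < e \<Longrightarrow> (of_real x :: quat) \<in> \<Omega>"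
    using ex_real_interval_in[OF \<Omega>] by blast
  show "\<forall>m\<le>n. a m = b m"
  proof (intro allI impI)
    fix k assume "k \<le> n"
    define c where "c m = (a m - b m) \<bullet> (a k - b k)" for m
    have "(\<Sum>m\<le>n. c m * x ^ m) = 0" if "x \<in> {x0 - e<..<x0 + e}" for x
    proof -
      have "(of_real x :: quat) \<in> \<Omega>" using that e(2)[of x] by auto
      then have "(\<Sum>m = 0..n. of_real x ^ m * a m) = (\<Sum>m = 0..n. of_real x ^ m * b m)"
        using fun_cong[OF eq, of "of_real x"] by (simp add: poly_fun_def)
      then have "(\<Sum>m\<le>n. x ^ m *\<^sub>R (a m - b m)) = 0"
        by (simp add: atMost_atLeast0 scaleR_conv_of_real right_diff_distrib sum_subtractf)
      then have "(\<Sum>m\<le>n. x ^ m *\<^sub>R (a m - b m)) \<bullet> (a k - b k) = 0" by simp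
      then show ?thesis by (simp add: inner_sum_left c_def mult.commute)
    qed
    then have "{x0 - e<..<x0 + e} \<subseteq> {x. (\<Sum>m\<le>n. c m * x ^ m) = 0}" by blast
    moreover have "infinite {x0 - e<..<x0 + e}" using e(1) by (simp add: infinite_Ioo)
    ultimately have "infinite {x. (\<Sum>m\<le>n. c m * x ^ m) = 0}" using finite_subset by blast
    then have "c k = 0" using \<open>k \<le> n\<close> by (auto simp: polyfun_finite_roots)
    then show "a k = b k" by (simp add: c_def)
  qed
next
  assume "\<forall>m\<le>n. a m = b m"
  then show "poly_fun \<Omega> n a = poly_fun \<Omega> n b"
    by (auto simp: poly_fun_def fun_eq_iff restrict_def)
qed

section \<open>Block triangular matrices\<close>

lemma matrix_eq_2: "A = B \<longleftrightarrow> A $ 1 $ 1 = B $ 1 $ 1 \<and> A $ 1 $ 2 = B $ 1 $ 2 \<and>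
    A $ 2 $ 1 = B $ 2 $ 1 \<and> A $ 2 $ 2 = B $ 2 $ 2" for A B :: "'a^2^2"
  by (auto simp: vec_eq_iff forall_2)

text \<open>The position of an index inside its block.\<close>
definition half :: "4 \<Rightarrow> 2" where "half k = (if k = 1 \<or> k = 3 then 1 else 2)"

definition lower_triangular :: "complex^2^2 \<Rightarrow> complex^2^2 \<Rightarrow> complex^2^2 \<Rightarrow> complex^4^4" where
  "lower_triangular A C D = (\<chi> r s.
     if r = 1 \<or> r = 2 then (if s = 1 \<or> s = 2 then A $ half r $ half s else 0)
     else (if s = 1 \<or> s = 2 then C $ half r $ half s else D $ half r $ half s))"

lemma blocks_lower_triangular:
  "block upper upper (lower_triangular A C D) = A" "block upper lower (lower_triangular A C D) = 0"
  "block lower upper (lower_triangular A C D) = C" "block lower lower (lower_triangular A C D) = D"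
  by (simp_all add: matrix_eq_2 block_def lower_triangular_def upper_def lower_def half_def)

lemma lower_triangular_mult:
  "lower_triangular A C D ** lower_triangular A' C' D' =
     lower_triangular (A ** A') (C ** A' + D ** C') (D ** D')"
  by (simp add: vec_eq_iff forall_4 matrix_matrix_mult_def sum_4 sum_2 lower_triangular_def half_def)

lemma lower_triangular_1: "lower_triangular (mat 1) 0 (mat 1) = mat 1"
  by (simp add: vec_eq_iff forall_4 lower_triangular_def half_def mat_def)

lemma block_scalar_mult: "block r s (mat (of_real t) ** T) = t *\<^sub>R block r s T"
  by (simp add: vec_eq_iff block_def matrix_matrix_mult_def mat_def if_distrib[where f = "\<lambda>x. x * _"]
      scaleR_conv_of_real[where 'a = complex] cong: if_cong)

section \<open>Quaternions as complex matrices\<close>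

text \<open>Only the zero vector of \<open>\<real>\<^sup>3\<close> is orthogonal to \<open>a\<close>, \<open>b\<close> and \<open>c = a \<times> b\<close> when \<open>a\<close>, \<open>b\<close> are orthonormal.
  Indeed \<open>r \<times> c = (r \<bullet> b) a - (r \<bullet> a) b = 0\<close>, while Lagrange's identity gives
  \<open>|r|\<^sup>2 |c|\<^sup>2 = (r \<bullet> c)\<^sup>2 + |r \<times> c|\<^sup>2\<close> and \<open>|c|\<^sup>2 = 1\<close>.\<close>
lemma orthonormal_triple_complete:
  fixes a1 a2 a3 b1 b2 b3 r1 r2 r3 :: real
  assumes a: "a1\<^sup>2 + a2\<^sup>2 + a3\<^sup>2 = 1" and b: "b1\<^sup>2 + b2\<^sup>2 + b3\<^sup>2 = 1"
    and ab: "a1 * b1 + a2 * b2 + a3 * b3 = 0"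
    and ra: "r1 * a1 + r2 * a2 + r3 * a3 = 0" and rb: "r1 * b1 + r2 * b2 + r3 * b3 = 0"
    and rc: "r1 * (a2 * b3 - a3 * b2) + r2 * (a3 * b1 - a1 * b3) + r3 * (a1 * b2 - a2 * b1) = 0"
  shows "r1 = 0 \<and> r2 = 0 \<and> r3 = 0"
proof -
  define c1 c2 c3 where "c1 = a2 * b3 - a3 * b2" and "c2 = a3 * b1 - a1 * b3"
    and "c3 = a1 * b2 - a2 * b1"
  note c = c1_def c2_def c3_def
  have cross: "r2 * c3 - r3 * c2 = 0" "r3 * c1 - r1 * c3 = 0" "r1 * c2 - r2 * c1 = 0"
    unfolding c using ra rb by algebra+
  have "c1\<^sup>2 + c2\<^sup>2 + c3\<^sup>2 =
    (a1\<^sup>2 + a2\<^sup>2 + a3\<^sup>2) * (b1\<^sup>2 + b2\<^sup>2 + b3\<^sup>2) - (a1 * b1 + a2 * b2 + a3 * b3)\<^sup>2"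
    unfolding c by algebra
  then have cc: "c1\<^sup>2 + c2\<^sup>2 + c3\<^sup>2 = 1" by (simp add: a b ab)
  have "(r1\<^sup>2 + r2\<^sup>2 + r3\<^sup>2) * (c1\<^sup>2 + c2\<^sup>2 + c3\<^sup>2) = (r1 * c1 + r2 * c2 + r3 * c3)\<^sup>2 +
      (r2 * c3 - r3 * c2)\<^sup>2 + (r3 * c1 - r1 * c3)\<^sup>2 + (r1 * c2 - r2 * c1)\<^sup>2"
    by algebra
  then have "r1\<^sup>2 + r2\<^sup>2 + r3\<^sup>2 = 0"
    using rc by (simp add: cc cross flip: c)
  then show ?thesis
    by (simp add: add_nonneg_eq_0_iff)
qed

locale anticommuting_units =
  fixes i j :: quat
  assumes i: "i \<in> imaginary_units" and j: "j \<in> imaginary_units"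
    and anticommute: "i * j = - (j * i)"
begin

text \<open>The coordinates \<open>\<alpha>\<close>, \<open>\<beta>\<close> of \<open>q = \<alpha> + \<beta> j\<close> are \<open>slice_coord i q\<close> and, because \<open>q j = \<alpha> j - \<beta>\<close>,
  \<open>- slice_coord i (q * j)\<close>.\<close>
definition qmat :: "quat \<Rightarrow> complex^2^2" where
  "qmat q = vector [vector [slice_coord i q, cnj (slice_coord i (q * j))],
                 vector [- slice_coord i (q * j), cnj (slice_coord i q)]]"

lemma qmat_entries [simp]:
  "qmat q $ 1 $ 1 = slice_coord i q" "qmat q $ 1 $ 2 = cnj (slice_coord i (q * j))"
  "qmat q $ 2 $ 1 = - slice_coord i (q * j)" "qmat q $ 2 $ 2 = cnj (slice_coord i q)"
  by (simp_all add: qmat_def)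

lemma jj: "j * j = - 1"
  by (rule imaginary_unit_square[OF j])

lemma inner_i_j: "j \<bullet> i = 0"
  using arg_cong[OF anticommute, of qre] imaginary_unitsD(1)[OF i] imaginary_unitsD(1)[OF j]
  by (simp add: times_quat_def inner_quat_def mult.commute)

lemma coord_1 [simp]: "slice_coord i 1 = 1" and coord_j [simp]: "slice_coord i j = 0"
  using imaginary_unitsD(1)[OF i] imaginary_unitsD(1)[OF j] inner_i_j
  by (simp_all add: slice_coord_def complex_eq_iff inner_quat_def)

lemma coord_slice_point [simp]: "slice_coord i (slice_point i z) = z"
  using slice_coord_mult_left[OF i, of z 1] by simp

text \<open>The two complex coordinates contain the four inner products of \<open>q\<close> with \<open>1\<close>, \<open>i\<close>, \<open>j\<close>
  and \<open>i j\<close>, up to sign, and these four quaternions form an orthonormal basis.\<close>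
lemma coord_pair_inject:
  assumes "slice_coord i p = slice_coord i q" and "slice_coord i (p * j) = slice_coord i (q * j)"
  shows "p = q"
proof -
  define r where "r = p - q"
  have r: "slice_coord i r = 0" "slice_coord i (r * j) = 0"
    using assms by (simp_all add: r_def slice_coord_diff left_diff_distrib)
  note ij = imaginary_unitsD[OF i] imaginary_unitsD[OF j]
  have r0: "qre r = 0" using r(1) by (simp add: slice_coord_def complex_eq_iff)
  have "qim1 r = 0 \<and> qim2 r = 0 \<and> qim3 r = 0"
    using ij(2) ij(4) inner_i_j r
    by (intro orthonormal_triple_complete[of "qim1 i" "qim2 i" "qim3 i" "qim1 j" "qim2 j" "qim3 j"])
      (simp_all add: slice_coord_def complex_eq_iff inner_quat_def times_quat_def ij(1) ij(3) r0
        algebra_simps)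
  with r0 have "r = 0" by (simp add: quat_eq_iff)
  then show ?thesis by (simp add: r_def)
qed

lemma coord_combination:
  "slice_coord i (slice_point i z + slice_point i w * j) = z"
  "slice_coord i ((slice_point i z + slice_point i w * j) * j) = - w"
  by (simp_all add: slice_coord_add slice_coord_diff distrib_right mult.assoc
      slice_coord_mult_left[OF i] jj)

lemma quat_decompose:
  "q = slice_point i (slice_coord i q) + slice_point i (- slice_coord i (q * j)) * j"
  by (rule coord_pair_inject) (simp_all add: coord_combination)

lemma splitting_eq: "splitting i j q = (slice_coord i q, - slice_coord i (q * j))"
  unfolding splitting_def
proof (rule the_equality)
  show "q = slice_point i (fst (slice_coord i q, - slice_coord i (q * j))) +
            slice_point i (snd (slice_coord i q, - slice_coord i (q * j))) * j"
    using quat_decompose by simp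
next
  fix p assume "q = slice_point i (fst p) + slice_point i (snd p) * j"
  then show "p = (slice_coord i q, - slice_coord i (q * j))"
    by (simp add: coord_combination prod_eq_iff)
qed

lemma j_slice_point: "j * slice_point i z = slice_point i (cnj z) * j"
proof -
  have "j * i = - (i * j)" using anticommute by simp
  then show ?thesis
    by (simp add: slice_point_def of_real_def algebra_simps)
qed

lemma coord_j_mult: "slice_coord i (j * q) = cnj (slice_coord i (q * j))"
proof -
  have "j * q = slice_point i (cnj (slice_coord i q)) * j +
      slice_point i (cnj (- slice_coord i (q * j))) * j * j"
    by (subst quat_decompose[of q]) (simp only: distrib_left mult.assoc[symmetric] j_slice_point)
  then show ?thesis
    by (simp add: slice_coord_diff mult.assoc jj slice_coord_mult_left[OF i])
qed

text \<open>Substitute \<open>p = \<alpha> + \<beta> j\<close> and use that passing \<open>j\<close> through \<open>\<real> + \<real> i\<close> conjugates.\<close>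
lemma coord_mult:
  "slice_coord i (p * q) =
     slice_coord i p * slice_coord i q - slice_coord i (p * j) * cnj (slice_coord i (q * j))"
proof -
  have "p * q = slice_point i (slice_coord i p) * q +
      slice_point i (- slice_coord i (p * j)) * (j * q)"
    by (subst quat_decompose[of p]) (simp only: distrib_right mult.assoc)
  then show ?thesis
    by (simp add: slice_coord_add slice_coord_mult_left[OF i] coord_j_mult)
qed

text \<open>The order is reversed because \<open>\<real> + \<real> i\<close> acts on the left in the decomposition \<open>\<alpha> + \<beta> j\<close>: right multiplications are
  then the complex linear maps, and \<open>qmat q\<close> is the matrix of right multiplication by \<open>q\<close> in the
  basis \<open>1, j\<close>.\<close>
lemma qmat_mult: "qmat (p * q) = qmat q ** qmat p"
proof -
  have "slice_coord i (p * q * j) =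
      slice_coord i p * slice_coord i (q * j) + slice_coord i (p * j) * cnj (slice_coord i q)"
    using coord_mult[of p "q * j"] by (simp add: mult.assoc jj slice_coord_minus)
  then show ?thesis
    by (simp add: matrix_eq_2 matrix_matrix_mult_def sum_2 coord_mult[of p q] algebra_simps
        del: mult.assoc)
qed

lemma qmat_add: "qmat (p + q) = qmat p + qmat q"
  by (simp add: matrix_eq_2 slice_coord_add distrib_right)

lemma qmat_scaleR: "qmat (r *\<^sub>R q) = r *\<^sub>R qmat q"
  by (simp add: matrix_eq_2 slice_coord_scaleR)

lemma qmat_0: "qmat 0 = 0" and qmat_1: "qmat 1 = mat 1"
  by (simp_all add: matrix_eq_2 mat_def)

lemma quat_matrices_eq_range: "quat_matrices = range qmat"
proof
  show "range qmat \<subseteq> quat_matrices"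
  proof
    fix A assume "A \<in> range qmat"
    then obtain q where "A = qmat q" by blast
    then have "A = vector [vector [slice_coord i q, - cnj (- slice_coord i (q * j))],
        vector [- slice_coord i (q * j), cnj (slice_coord i q)]]" by (simp add: qmat_def)
    then show "A \<in> quat_matrices" unfolding quat_matrices_def by blast
  qed
  show "quat_matrices \<subseteq> range qmat"
  proof
    fix A assume "A \<in> quat_matrices"
    then obtain z w where "A = vector [vector [z, - cnj w], vector [w, cnj z]]"
      by (auto simp: quat_matrices_def)
    then have "A = qmat (slice_point i z + slice_point i w * j)"
      by (simp only: qmat_def coord_combination complex_cnj_minus minus_minus)
    then show "A \<in> range qmat" by blast
  qed
qed

lemma matrix_inv_qmat:
  assumes "p \<noteq> 0"
  shows "matrix_inv (qmat p) = qmat (inverse p)"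
proof -
  have inv: "qmat p ** qmat (inverse p) = mat 1" "qmat (inverse p) ** qmat p = mat 1"
    using assms by (simp_all add: qmat_1 flip: qmat_mult)
  have "qmat p ** matrix_inv (qmat p) = mat 1 \<and> matrix_inv (qmat p) ** qmat p = mat 1"
    unfolding matrix_inv_def by (rule someI[of _ "qmat (inverse p)"]) (simp add: inv)
  then have "matrix_inv (qmat p) ** qmat p ** qmat (inverse p) = qmat (inverse p)" by simp
  then show ?thesis by (simp add: inv flip: matrix_mul_assoc)
qed

text \<open>The left inverse has diagonal blocks \<open>A\<^sup>-\<^sup>1\<close>, \<open>D\<^sup>-\<^sup>1\<close>; its lower left block \<open>- D\<^sup>-\<^sup>1 C A\<^sup>-\<^sup>1\<close> is the matrix of
  \<open>- p\<^sup>-\<^sup>1 c d\<^sup>-\<^sup>1\<close>, as products are reversed.\<close>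
lemma lower_triangular_in_B_H:
  assumes "p \<noteq> 0" and "d \<noteq> 0"
  shows "lower_triangular (qmat p) (qmat c) (qmat d) \<in> carrier B_H"
proof -
  let ?c' = "- (inverse p * c * inverse d)"
  have "lower_triangular (qmat (inverse p)) (qmat ?c') (qmat (inverse d)) **
      lower_triangular (qmat p) (qmat c) (qmat d) =
      lower_triangular (qmat (p * inverse p)) (qmat (p * ?c' + c * inverse d)) (qmat (d * inverse d))"
    by (simp only: lower_triangular_mult qmat_mult qmat_add)
  also have "\<dots> = mat 1"
    using assms by (simp add: qmat_0 qmat_1 lower_triangular_1 mult.assoc[symmetric])
  finally have "invertible (lower_triangular (qmat p) (qmat c) (qmat d))"
    using invertible_left_inverse by blast
  then show ?thesis
    by (simp add: B_H_def blocks_lower_triangular quat_matrices_eq_range)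
qed

text \<open>If a diagonal block vanished, then the first row or the third column of \<open>T\<close> would vanish, contrary to
  invertibility.\<close>
lemma carrier_B_H_blocks:
  assumes "T \<in> carrier B_H"
  obtains p c d where "p \<noteq> 0" "d \<noteq> 0"
    "block upper upper T = qmat p" "block lower upper T = qmat c" "block lower lower T = qmat d"
proof -
  have T: "invertible T" "block upper lower T = 0" "block upper upper T \<in> range qmat"
      "block lower upper T \<in> range qmat" "block lower lower T \<in> range qmat"
    using assms by (simp_all add: B_H_def quat_matrices_eq_range)
  then obtain p c d where blocks: "block upper upper T = qmat p" "block lower upper T = qmat c"
      "block lower lower T = qmat d"
    by blast
  obtain S where S: "T ** S = mat 1" "S ** T = mat 1"
    using T(1) by (auto simp: invertible_def)
  have ur: "T $ 1 $ 3 = 0" "T $ 1 $ 4 = 0" "T $ 2 $ 3 = 0" "T $ 2 $ 4 = 0"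
    using T(2) by (simp_all add: matrix_eq_2 block_def upper_def lower_def)
  have "p \<noteq> 0"
  proof
    assume "p = 0"
    then have "block upper upper T = 0" using blocks qmat_0 by simp
    then have "T $ 1 $ 1 = 0" "T $ 1 $ 2 = 0"
      by (simp_all add: matrix_eq_2 block_def upper_def)
    then have "(T ** S) $ 1 $ 1 = 0"
      by (simp add: matrix_matrix_mult_def sum_4 ur)
    then show False by (simp add: S mat_def)
  qed
  moreover have "d \<noteq> 0"
  proof
    assume "d = 0"
    then have "block lower lower T = 0" using blocks qmat_0 by simp
    then have "T $ 3 $ 3 = 0" "T $ 4 $ 3 = 0"
      by (simp_all add: matrix_eq_2 block_def lower_def)
    then have "(S ** T) $ 3 $ 3 = 0"
      by (simp add: matrix_matrix_mult_def sum_4 ur)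
    then show False by (simp add: S mat_def)
  qed
  ultimately show ?thesis using blocks by (rule that)
qed

end

section \<open>The action on polynomials\<close>

text \<open>The coefficients of \<open>p\<^sup>-\<^sup>1 (f d + c)\<close>, with products taken coefficientwise.\<close>
definition affine_coeffs :: "quat \<Rightarrow> quat \<Rightarrow> quat \<Rightarrow> (nat \<Rightarrow> quat) \<Rightarrow> nat \<Rightarrow> quat" where
  "affine_coeffs p c d a m = inverse p * (a m * d + (if m = 0 then c else 0))"

text \<open>Real scalars are central and cancel. For this reason a coset modulo the real scalars acts on polynomials.\<close>
lemma affine_coeffs_scaleR:
  "r \<noteq> 0 \<Longrightarrow> affine_coeffs (r *\<^sub>R p) (r *\<^sub>R c) (r *\<^sub>R d) = affine_coeffs p c d"
  by (simp add: affine_coeffs_def fun_eq_iff distrib_left inverse_scaleR_distrib)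

locale slice_setting = anticommuting_units +
  fixes \<Omega> :: "quat set"
  assumes \<Omega>: "symmetric_slice_domain \<Omega>"
begin

lemma open_slice: "I \<in> imaginary_units \<Longrightarrow> open (slice I \<Omega>)"
  using \<Omega> by (simp add: symmetric_slice_domain_def)

text \<open>The conjugate point lies on the slice of \<open>- i\<close>, so the symmetry of \<open>\<Omega>\<close> applies. Without it,
  \<open>hat\<close> would evaluate functions outside their domain.\<close>
lemma cnj_in_slice:
  assumes "z \<in> slice i \<Omega>"
  shows "cnj z \<in> slice i \<Omega>"
proof -
  have "of_real (Re z) + of_real (Im z) * - i \<in> \<Omega>"
    using assms \<Omega> i minus_imaginary_units[OF i]
    unfolding symmetric_slice_domain_def slice_def slice_point_def by blast
  then show ?thesis by (simp add: slice_def slice_point_def)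
qed

text \<open>Powers of a point of the slice of \<open>i\<close> lie in \<open>\<real> + \<real> i\<close> and come out of the coordinates; the two
  conjugations in \<open>hat\<close> cancel on \<open>z\<close> and act on the coefficients only.\<close>
lemma \<Phi>_poly_fun:
  assumes z: "z \<in> slice i \<Omega>"
  shows "\<Phi> i j (poly_fun \<Omega> n a) z $ r $ s = (\<Sum>m = 0..n. z ^ m * qmat (a m) $ r $ s)"
proof -
  have coord: "slice_coord i (poly_fun \<Omega> n a (slice_point i w) * q) =
      (\<Sum>m = 0..n. w ^ m * slice_coord i (a m * q))" if "w \<in> slice i \<Omega>" for w q
    using that by (simp add: poly_fun_def slice_def sum_distrib_right slice_coord_sum mult.assoc
        slice_coord_mult_left[OF i] flip: slice_point_power[OF i])
  have "split_fst i j (poly_fun \<Omega> n a) w = (\<Sum>m = 0..n. w ^ m * slice_coord i (a m))"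
    "split_snd i j (poly_fun \<Omega> n a) w = (\<Sum>m = 0..n. w ^ m * - slice_coord i (a m * j))"
    if "w \<in> slice i \<Omega>" for w
    using coord[OF that, of 1] coord[OF that, of j]
    by (simp_all add: split_fst_def split_snd_def splitting_eq sum_negf)
  note split = this[OF z] this[OF cnj_in_slice[OF z]]
  have "r = 1 \<or> r = 2" "s = 1 \<or> s = 2" by (rule exhaust_2)+
  then show ?thesis
    by (auto simp: \<Phi>_def hat_def split sum_negf)
qed

text \<open>The scalars \<open>z\<^sup>m\<close> commute with the constant matrices, so the action passes to the coefficients,
  where the reversal of products turns \<open>D qmat(a\<^sub>m) A\<^sup>-\<^sup>1\<close> into \<open>qmat(p\<^sup>-\<^sup>1 a\<^sub>m d)\<close>.\<close>
lemma \<Phi>_affine: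
  assumes "z \<in> slice i \<Omega>"
  shows "(qmat c + qmat d ** \<Phi> i j (poly_fun \<Omega> n a) z) ** qmat (inverse p) =
    \<Phi> i j (poly_fun \<Omega> n (affine_coeffs p c d a)) z"
proof -
  have coeff: "qmat (affine_coeffs p c d a m) $ r $ s = (qmat d ** qmat (a m) ** qmat (inverse p)) $ r $ s +
      (if m = 0 then (qmat c ** qmat (inverse p)) $ r $ s else 0)" for m r s
    by (simp add: affine_coeffs_def qmat_mult qmat_add qmat_0 matrix_matrix_mult_def sum_2
        distrib_right del: qmat_entries)
  have const: "(\<Sum>m = 0..n. z ^ m * (if m = 0 then w else 0)) = w" for w :: complex
    by (simp add: sum.atLeast_Suc_atMost)
  have "((qmat c + qmat d ** \<Phi> i j (poly_fun \<Omega> n a) z) ** qmat (inverse p)) $ r $ s =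
      (\<Sum>m = 0..n. z ^ m * (qmat d ** qmat (a m) ** qmat (inverse p)) $ r $ s) +
      (qmat c ** qmat (inverse p)) $ r $ s" for r s
    by (simp add: \<Phi>_poly_fun[OF assms] matrix_matrix_mult_def sum_2 sum.distrib
        sum_distrib_left sum_distrib_right algebra_simps del: qmat_entries)
  then show ?thesis
    by (simp only: vec_eq_iff \<Phi>_poly_fun[OF assms] coeff distrib_left sum.distrib const) simp
qed

text \<open>The first column of \<open>\<Phi>\<close> gives both coordinates of the values on the slice of \<open>i\<close>, in particular
  at the real points.\<close>
lemma slice_regular_eq_if_\<Phi>_eq:
  assumes f: "f \<in> slice_regular_on \<Omega>" and g: "g \<in> slice_regular_on \<Omega>"
    and eq: "\<And>z. z \<in> slice i \<Omega> \<Longrightarrow> \<Phi> i j f z = \<Phi> i j g z"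
  shows "f = g"
proof (rule slice_regular_eqI[OF \<Omega> f g])
  fix x :: real assume "(of_real x :: quat) \<in> \<Omega>"
  then have "\<Phi> i j f (of_real x) = \<Phi> i j g (of_real x)"
    by (intro eq) (simp add: slice_def)
  then have "split_fst i j f (of_real x) = split_fst i j g (of_real x)"
    "split_snd i j f (of_real x) = split_snd i j g (of_real x)"
    by (simp_all add: matrix_eq_2 \<Phi>_def)
  then show "f (of_real x) = g (of_real x)"
    by (intro coord_pair_inject) (simp_all add: split_fst_def split_snd_def splitting_eq)
qed

lemma coset_scalars:
  "T' \<in> real_scalars #>\<^bsub>B_H\<^esub> T \<longleftrightarrow> (\<exists>r :: real. r \<noteq> 0 \<and> T' = mat (of_real r) ** T)"
  by (auto simp: r_coset_def real_scalars_def B_H_def)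

text \<open>Other representatives of the coset scale \<open>p\<close>, \<open>c\<close> and \<open>d\<close> by the same real number, so the polynomial satisfies
  the defining equation for all of them; uniqueness needs the equation for \<open>T\<close> alone.\<close>
lemma pullback_poly_fun:
  assumes p: "p \<noteq> 0" and T: "block upper upper T = qmat p" "block lower upper T = qmat c"
    "block lower lower T = qmat d"
  shows "pullback i j \<Omega> (real_scalars #>\<^bsub>B_H\<^esub> T) (poly_fun \<Omega> n a) =
    poly_fun \<Omega> n (affine_coeffs p c d a)"
  unfolding pullback_def
proof (rule the_equality)
  let ?P = "poly_fun \<Omega> n (affine_coeffs p c d a)"
  have P: "?P \<in> slice_regular_on \<Omega>"
    by (intro poly_fun_slice_regular open_slice)
  have transform: "(block lower upper T' + block lower lower T' ** \<Phi> i j (poly_fun \<Omega> n a) z) **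
      matrix_inv (block upper upper T') = \<Phi> i j ?P z"
    if T': "T' \<in> real_scalars #>\<^bsub>B_H\<^esub> T" and z: "z \<in> slice i \<Omega>" for T' z
  proof -
    obtain r :: real where r: "r \<noteq> 0" and "T' = mat (of_real r) ** T"
      using T' coset_scalars by blast
    then have "block upper upper T' = qmat (r *\<^sub>R p)" "block lower upper T' = qmat (r *\<^sub>R c)"
      "block lower lower T' = qmat (r *\<^sub>R d)"
      by (simp_all add: block_scalar_mult T qmat_scaleR)
    then show ?thesis
      using p r \<Phi>_affine[OF z, of "r *\<^sub>R c" "r *\<^sub>R d" n a "r *\<^sub>R p"]
        matrix_inv_qmat[of "r *\<^sub>R p"] by (simp add: affine_coeffs_scaleR)
  qed
  then show "?P \<in> slice_regular_on \<Omega> \<and> (\<forall>T'\<in>real_scalars #>\<^bsub>B_H\<^esub> T. \<forall>z\<in>slice i \<Omega>.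
      \<Phi> i j ?P z = (block lower upper T' + block lower lower T' ** \<Phi> i j (poly_fun \<Omega> n a) z) **
        matrix_inv (block upper upper T'))"
    using P by simp
  fix F assume F: "F \<in> slice_regular_on \<Omega> \<and> (\<forall>T'\<in>real_scalars #>\<^bsub>B_H\<^esub> T. \<forall>z\<in>slice i \<Omega>.
      \<Phi> i j F z = (block lower upper T' + block lower lower T' ** \<Phi> i j (poly_fun \<Omega> n a) z) **
        matrix_inv (block upper upper T'))"
  have "T \<in> real_scalars #>\<^bsub>B_H\<^esub> T"
    unfolding coset_scalars by (intro exI[of _ 1]) simp
  then have "\<Phi> i j F z = \<Phi> i j ?P z" if "z \<in> slice i \<Omega>" for z
    using F that transform[of T z] by simp
  then show "F = ?P"
    using F P by (intro slice_regular_eq_if_\<Phi>_eq) simp_all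
qed

lemma \<Gamma>_equivalent_iff_affine:
  "\<Gamma>_equivalent i j \<Omega> (poly_fun \<Omega> n a) (poly_fun \<Omega> n b) \<longleftrightarrow>
     (\<exists>p c d. p \<noteq> 0 \<and> d \<noteq> 0 \<and> (\<forall>m\<le>n. b m = affine_coeffs p c d a m))"
proof
  assume "\<Gamma>_equivalent i j \<Omega> (poly_fun \<Omega> n a) (poly_fun \<Omega> n b)"
  then obtain T where T: "T \<in> carrier B_H"
    and b: "poly_fun \<Omega> n b = pullback i j \<Omega> (real_scalars #>\<^bsub>B_H\<^esub> T) (poly_fun \<Omega> n a)"
    by (auto simp: \<Gamma>_equivalent_def \<Gamma>_univ_def FactGroup_def RCOSETS_def)
  obtain p c d where pd: "p \<noteq> 0" "d \<noteq> 0"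
    and blocks: "block upper upper T = qmat p" "block lower upper T = qmat c" "block lower lower T = qmat d"
    using T by (rule carrier_B_H_blocks)
  show "\<exists>p c d. p \<noteq> 0 \<and> d \<noteq> 0 \<and> (\<forall>m\<le>n. b m = affine_coeffs p c d a m)"
    using pd b unfolding pullback_poly_fun[OF pd(1) blocks] poly_fun_eq_iff[OF \<Omega>] by blast
next
  assume "\<exists>p c d. p \<noteq> 0 \<and> d \<noteq> 0 \<and> (\<forall>m\<le>n. b m = affine_coeffs p c d a m)"
  then obtain p c d where pd: "p \<noteq> 0" "d \<noteq> 0" and b: "\<forall>m\<le>n. b m = affine_coeffs p c d a m"
    by blast
  let ?T = "lower_triangular (qmat p) (qmat c) (qmat d)"
  have "real_scalars #>\<^bsub>B_H\<^esub> ?T \<in> carrier \<Gamma>_univ"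
    using lower_triangular_in_B_H[OF pd] by (auto simp: \<Gamma>_univ_def FactGroup_def RCOSETS_def)
  moreover have "poly_fun \<Omega> n b = pullback i j \<Omega> (real_scalars #>\<^bsub>B_H\<^esub> ?T) (poly_fun \<Omega> n a)"
    using b by (simp add: pullback_poly_fun[OF pd(1)] blocks_lower_triangular poly_fun_eq_iff[OF \<Omega>])
  ultimately show "\<Gamma>_equivalent i j \<Omega> (poly_fun \<Omega> n a) (poly_fun \<Omega> n b)"
    unfolding \<Gamma>_equivalent_def by blast
qed

text \<open>If \<open>b\<^sub>m = p\<^sup>-\<^sup>1 a\<^sub>m d\<close> for \<open>m \<ge> 1\<close>, then \<open>d\<close> cancels in \<open>b\<^sub>m b\<^sub>n\<^sup>-\<^sup>1\<close> and \<open>\<eta> = p\<^sup>-\<^sup>1\<close> conjugates. Conversely put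
  \<open>p = \<eta>\<^sup>-\<^sup>1\<close> and solve the equations for \<open>m = n\<close> and \<open>m = 0\<close> for \<open>d\<close> and \<open>c\<close>; since \<open>n \<ge> 1\<close>,
  these are different equations.\<close>
lemma \<Gamma>_equivalent_iff_conjugate:
  assumes n: "n \<ge> 1" and an: "a n \<noteq> 0" and bn: "b n \<noteq> 0"
  shows "\<Gamma>_equivalent i j \<Omega> (poly_fun \<Omega> n a) (poly_fun \<Omega> n b) \<longleftrightarrow>
    (\<exists>\<eta>. \<eta> \<noteq> 0 \<and> (\<forall>m\<in>{1..n - 1}. b m * inverse (b n) = \<eta> * (a m * inverse (a n)) * inverse \<eta>))"
  unfolding \<Gamma>_equivalent_iff_affine
proof
  assume "\<exists>p c d. p \<noteq> 0 \<and> d \<noteq> 0 \<and> (\<forall>m\<le>n. b m = affine_coeffs p c d a m)"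
  then obtain p c d where pd: "p \<noteq> 0" "d \<noteq> 0" and b: "\<And>m. m \<le> n \<Longrightarrow> b m = affine_coeffs p c d a m"
    by blast
  have "b m * inverse (b n) = inverse p * (a m * inverse (a n)) * inverse (inverse p)"
    if "m \<in> {1..n - 1}" for m
  proof -
    have "b m = inverse p * a m * d" "b n = inverse p * a n * d"
      using that n b by (auto simp: affine_coeffs_def mult.assoc)
    moreover from this have "inverse (b n) = inverse d * (inverse (a n) * p)"
      using pd an by (simp add: nonzero_inverse_mult_distrib mult.assoc)
    ultimately have "b m * inverse (b n) = inverse p * a m * (d * inverse d) * (inverse (a n) * p)"
      by (simp only: mult.assoc)
    then show ?thesis using pd by (simp add: mult.assoc)
  qed
  then show "\<exists>\<eta>. \<eta> \<noteq> 0 \<and>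
      (\<forall>m\<in>{1..n - 1}. b m * inverse (b n) = \<eta> * (a m * inverse (a n)) * inverse \<eta>)"
    using pd by (intro exI[of _ "inverse p"]) simp
next
  assume "\<exists>\<eta>. \<eta> \<noteq> 0 \<and>
      (\<forall>m\<in>{1..n - 1}. b m * inverse (b n) = \<eta> * (a m * inverse (a n)) * inverse \<eta>)"
  then obtain \<eta> where \<eta>: "\<eta> \<noteq> 0"
    and conj: "\<And>m. m \<in> {1..n - 1} \<Longrightarrow> b m * inverse (b n) = \<eta> * (a m * inverse (a n)) * inverse \<eta>"
    by blast
  define d where "d = inverse (a n) * inverse \<eta> * b n"
  define c where "c = inverse \<eta> * b 0 - a 0 * d"
  have "b m = affine_coeffs (inverse \<eta>) c d a m" if "m \<le> n" for m
  proof -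
    consider "m = 0" | "m = n" "m \<noteq> 0" | "m \<in> {1..n - 1}" using \<open>m \<le> n\<close> by force
    then show ?thesis
    proof cases
      case 1
      then show ?thesis using \<eta> by (simp add: affine_coeffs_def c_def mult.assoc[symmetric])
    next
      case 2
      then show ?thesis using \<eta> an by (simp add: affine_coeffs_def d_def mult.assoc[symmetric])
    next
      case 3
      have "b m = b m * inverse (b n) * b n" using bn by (simp add: mult.assoc)
      also have "\<dots> = \<eta> * (a m * d)" by (simp add: conj[OF 3] d_def mult.assoc)
      finally show ?thesis using 3 by (simp add: affine_coeffs_def)
    qed
  qed
  moreover have "d \<noteq> 0" using \<eta> an bn by (simp add: d_def)
  ultimately show "\<exists>p c d. p \<noteq> 0 \<and> d \<noteq> 0 \<and> (\<forall>m\<le>n. b m = affine_coeffs p c d a m)"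
    using \<eta> by (intro exI[of _ "inverse \<eta>"] exI[of _ c] exI[of _ d]) simp
qed

end

section \<open>Normalisation\<close>

lemma normal_fun_eq_poly_fun:
  assumes "n \<ge> 1"
  shows "normal_fun \<Omega> n b = poly_fun \<Omega> n (\<lambda>m. if m = 0 then 0 else if m = n then 1 else b m)"
proof -
  obtain k where k: "n = Suc k" using assms by (cases n) auto
  have "(\<Sum>m = 0..n. q ^ m * (if m = 0 then 0 else if m = n then 1 else b m)) =
      q ^ n + (\<Sum>m = 1..n - 1. q ^ m * b m)" for q
    by (simp add: k sum.atLeast_Suc_atMost[of 0 k] add.commute)
  then show ?thesis
    by (simp add: normal_fun_def poly_fun_def fun_eq_iff restrict_def)
qed

lemma normal_fun_eq_iff:
  assumes "symmetric_slice_domain \<Omega>" and "n \<ge> 1"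
  shows "normal_fun \<Omega> n b = normal_fun \<Omega> n c \<longleftrightarrow> (\<forall>m\<in>{1..n - 1}. b m = c m)"
  unfolding normal_fun_eq_poly_fun[OF assms(2)] poly_fun_eq_iff[OF assms(1)]
  by (auto simp: Ball_def split: if_splits)

lemma normalise_poly_fun:
  assumes "symmetric_slice_domain \<Omega>" and "n \<ge> 1" and "a n \<noteq> 0"
  shows "normalise \<Omega> n (poly_fun \<Omega> n a) = normal_fun \<Omega> n (\<lambda>m. a m * inverse (a n))"
  unfolding normalise_def
proof (rule the_equality)
  show "\<exists>a'. a' n \<noteq> 0 \<and> poly_fun \<Omega> n a = poly_fun \<Omega> n a' \<and>
      normal_fun \<Omega> n (\<lambda>m. a m * inverse (a n)) = normal_fun \<Omega> n (\<lambda>m. a' m * inverse (a' n))"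
    using assms(3) by blast
next
  fix F assume "\<exists>a'. a' n \<noteq> 0 \<and> poly_fun \<Omega> n a = poly_fun \<Omega> n a' \<and>
      F = normal_fun \<Omega> n (\<lambda>m. a' m * inverse (a' n))"
  then show "F = normal_fun \<Omega> n (\<lambda>m. a m * inverse (a n))"
    by (auto simp: poly_fun_eq_iff[OF assms(1)] normal_fun_eq_iff[OF assms(1,2)])
qed

lemma normalise_image:
  assumes "symmetric_slice_domain \<Omega>" and "n \<ge> 1"
  shows "normalise \<Omega> n ` polys \<Omega> n = normal_polys \<Omega> n"
proof
  show "normalise \<Omega> n ` polys \<Omega> n \<subseteq> normal_polys \<Omega> n"
    by (auto simp: polys_def normal_polys_def normalise_poly_fun[OF assms])
  show "normal_polys \<Omega> n \<subseteq> normalise \<Omega> n ` polys \<Omega> n"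
  proof
    fix F assume "F \<in> normal_polys \<Omega> n"
    then obtain b where F: "F = normal_fun \<Omega> n b" by (auto simp: normal_polys_def)
    define a where "a m = (if m = 0 then 0 else if m = n then 1 else b m)" for m
    have an: "a n = 1" using assms(2) by (simp add: a_def)
    then have "normalise \<Omega> n (poly_fun \<Omega> n a) = F"
      using assms(2) by (auto simp: F normalise_poly_fun[OF assms] normal_fun_eq_iff[OF assms] a_def)
    moreover have "poly_fun \<Omega> n a \<in> polys \<Omega> n" using an by (auto simp: polys_def)
    ultimately show "F \<in> normalise \<Omega> n ` polys \<Omega> n" by blast
  qed
qed

lemma conj_rel_iff:
  assumes "symmetric_slice_domain \<Omega>" and "n \<ge> 1"
  shows "(normal_fun \<Omega> n b, normal_fun \<Omega> n c) \<in> conj_rel \<Omega> n \<longleftrightarrow>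
    (\<exists>\<eta>. \<eta> \<noteq> 0 \<and> (\<forall>m\<in>{1..n - 1}. c m = \<eta> * b m * inverse \<eta>))"
proof
  assume "(normal_fun \<Omega> n b, normal_fun \<Omega> n c) \<in> conj_rel \<Omega> n"
  then obtain b' c' \<eta> where "normal_fun \<Omega> n b = normal_fun \<Omega> n b'"
    "normal_fun \<Omega> n c = normal_fun \<Omega> n c'" "\<eta> \<noteq> 0" "\<forall>m\<in>{1..n - 1}. c' m = \<eta> * b' m * inverse \<eta>"
    by (auto simp: conj_rel_def)
  then show "\<exists>\<eta>. \<eta> \<noteq> 0 \<and> (\<forall>m\<in>{1..n - 1}. c m = \<eta> * b m * inverse \<eta>)"
    unfolding normal_fun_eq_iff[OF assms] by (intro exI[of _ \<eta>]) simp
qed (auto simp: conj_rel_def)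

lemma equiv_conj_rel:
  assumes \<Omega>: "symmetric_slice_domain \<Omega>" and n: "n \<ge> 1"
  shows "equiv (normal_polys \<Omega> n) (conj_rel \<Omega> n)"
proof (rule equivI)
  show "conj_rel \<Omega> n \<subseteq> normal_polys \<Omega> n \<times> normal_polys \<Omega> n"
    by (auto simp: conj_rel_def normal_polys_def)
  have "(normal_fun \<Omega> n b, normal_fun \<Omega> n b) \<in> conj_rel \<Omega> n" for b
    unfolding conj_rel_iff[OF assms] by (intro exI[of _ 1]) simp
  then show "refl_on (normal_polys \<Omega> n) (conj_rel \<Omega> n)"
    by (auto simp: refl_on_def normal_polys_def)
  show "sym (conj_rel \<Omega> n)"
  proof (rule symI)
    fix f g assume "(f, g) \<in> conj_rel \<Omega> n"
    then obtain b c \<eta> where fg: "f = normal_fun \<Omega> n b" "g = normal_fun \<Omega> n c"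
      and \<eta>: "\<eta> \<noteq> 0" "\<forall>m\<in>{1..n - 1}. c m = \<eta> * b m * inverse \<eta>"
      by (auto simp: conj_rel_def)
    have "\<forall>m\<in>{1..n - 1}. b m = inverse \<eta> * c m * inverse (inverse \<eta>)"
      using \<eta> by (simp add: mult.assoc) (simp add: mult.assoc[symmetric])
    then show "(g, f) \<in> conj_rel \<Omega> n"
      unfolding fg conj_rel_iff[OF assms] using \<eta>(1) by (intro exI[of _ "inverse \<eta>"]) simp
  qed
  show "trans (conj_rel \<Omega> n)"
  proof (rule transI)
    fix f g h assume fg: "(f, g) \<in> conj_rel \<Omega> n" and gh: "(g, h) \<in> conj_rel \<Omega> n"
    obtain b c d where fgh: "f = normal_fun \<Omega> n b" "g = normal_fun \<Omega> n c" "h = normal_fun \<Omega> n d"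
      using fg gh by (auto simp: conj_rel_def)
    obtain \<eta> \<theta> where "\<eta> \<noteq> 0" "\<forall>m\<in>{1..n - 1}. c m = \<eta> * b m * inverse \<eta>"
      "\<theta> \<noteq> 0" "\<forall>m\<in>{1..n - 1}. d m = \<theta> * c m * inverse \<theta>"
      using fg gh unfolding fgh conj_rel_iff[OF assms] by blast
    then show "(f, h) \<in> conj_rel \<Omega> n"
      unfolding fgh conj_rel_iff[OF assms]
      by (intro exI[of _ "\<theta> * \<eta>"]) (simp add: nonzero_inverse_mult_distrib mult.assoc)
  qed
qed

section \<open>The bijection of quotients\<close>

text \<open>The map takes a class to its image under \<open>N\<close>, which is a whole class of \<open>R\<close> because \<open>N\<close> is onto \<open>B\<close>.\<close>
lemma quotient_bijection:
  assumes E: "equiv B R" and N: "N ` A = B"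
    and Q: "Q = {(x, y) \<in> A \<times> A. (N x, N y) \<in> R}"
  shows "\<exists>F. (\<forall>x\<in>A. F (Q `` {x}) = R `` {N x}) \<and> bij_betw F (A // Q) (B // R)"
proof (intro exI conjI ballI)
  let ?F = "\<lambda>X. N ` X"
  show F: "?F (Q `` {x}) = R `` {N x}" if "x \<in> A" for x
  proof
    show "N ` (Q `` {x}) \<subseteq> R `` {N x}" using Q by auto
    show "R `` {N x} \<subseteq> N ` (Q `` {x})"
    proof
      fix y assume y: "y \<in> R `` {N x}"
      then have "y \<in> B" using equiv_class_eq_iff[OF E] by blast
      then obtain x' where "x' \<in> A" "y = N x'" using N by blast
      then show "y \<in> N ` (Q `` {x})" using Q y that by auto
    qed
  qed
  have Q_class: "Q `` {x} = Q `` {y}" if "x \<in> A" "y \<in> A" "R `` {N x} = R `` {N y}" for x y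
  proof -
    have "(N x, z) \<in> R \<longleftrightarrow> (N y, z) \<in> R" for z using that(3) by blast
    then show ?thesis using Q that by auto
  qed
  have "inj_on ?F (A // Q)"
  proof (rule inj_onI)
    fix X Y assume "X \<in> A // Q" "Y \<in> A // Q" and eq: "?F X = ?F Y"
    then obtain x y where "x \<in> A" "X = Q `` {x}" "y \<in> A" "Y = Q `` {y}"
      by (elim quotientE)
    with eq show "X = Y" using Q_class[of x y] F by simp
  qed
  moreover have "?F ` (A // Q) = B // R"
    unfolding quotient_def N[symmetric] by (auto simp: F image_iff)
  ultimately show "bij_betw ?F (A // Q) (B // R)"
    by (simp add: bij_betw_def)
qed

theorem theorem5p21:
  fixes i j :: quat and \<Omega> :: "quat set" and n :: nat
  assumes "i \<in> imaginary_units" and "j \<in> imaginary_units" and "i * j = - (j * i)"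
    and "symmetric_slice_domain \<Omega>"
    and "n \<ge> 1"
  shows "(\<forall>a b :: nat \<Rightarrow> quat. a n \<noteq> 0 \<longrightarrow> b n \<noteq> 0 \<longrightarrow>
            (\<Gamma>_equivalent i j \<Omega> (poly_fun \<Omega> n a) (poly_fun \<Omega> n b) \<longleftrightarrow>
             (\<exists>\<eta>. \<eta> \<noteq> 0 \<and>
                (\<forall>m\<in>{1..n - 1}. b m * inverse (b n) = \<eta> * (a m * inverse (a n)) * inverse \<eta>)))) \<and>
         (\<exists>F. (\<forall>f\<in>polys \<Omega> n. F (\<Gamma>_rel i j \<Omega> n `` {f}) = conj_rel \<Omega> n `` {normalise \<Omega> n f}) \<and>
              bij_betw F (polys \<Omega> n // \<Gamma>_rel i j \<Omega> n) (normal_polys \<Omega> n // conj_rel \<Omega> n))"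
proof -
  interpret slice_setting i j \<Omega>
    using assms by unfold_locales
  note equivalent = \<Gamma>_equivalent_iff_conjugate[OF \<open>n \<ge> 1\<close>]
  note normalise = normalise_poly_fun[OF assms(4,5)]
  have "\<Gamma>_rel i j \<Omega> n =
      {(f, h) \<in> polys \<Omega> n \<times> polys \<Omega> n. (normalise \<Omega> n f, normalise \<Omega> n h) \<in> conj_rel \<Omega> n}"
    by (auto simp: \<Gamma>_rel_def polys_def equivalent normalise conj_rel_iff[OF assms(4,5)])
  then have "\<exists>F. (\<forall>f\<in>polys \<Omega> n. F (\<Gamma>_rel i j \<Omega> n `` {f}) = conj_rel \<Omega> n `` {normalise \<Omega> n f}) \<and>
      bij_betw F (polys \<Omega> n // \<Gamma>_rel i j \<Omega> n) (normal_polys \<Omega> n // conj_rel \<Omega> n)"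
    by (rule quotient_bijection[OF equiv_conj_rel[OF assms(4,5)] normalise_image[OF assms(4,5)]])
  then show ?thesis
    using equivalent by blast
qed

end
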